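(* Let $H$ be an induced subgraph of the $d$-dimensional grid graph $P_{n_1}\square\cdots\square P_{n_d}$, and let $2\le \ell\le 2d-1$. Then $$|S_\ell|\le Z_{(\ell)}(H)\le |\delta H|,$$ where $S_\ell=\{v\in V(H):\deg_H(v)\le \ell\}$. In particular, when $\ell=2d-1$, $Z_{(\ell)}(H)=|\delta H|$.
   Context: All graphs are finite, simple and undirected; $\deg_G(v)$ is the degree of $v$ in $G$. $P_n$ is the path on $n$ vertices, and $P_{n_1}\square\cdots\square P_{n_d}$ is the Cartesian product: its vertices are the tuples in $V(P_{n_1})\times\cdots\times V(P_{n_d})$, and two tuples are adjacent iff they differ in exactly one coordinate $k$ and their $k$-th coordinates are adjacent in $P_{n_k}$. Zero forcing color change rule: given a coloring of $V(G)$ in blue and white, a blue vertex $u$ having exactly one white neighbor $v$ may force $v$ to become blue. For an integer $\ell\ge0$, a set $B\subseteq V(G)$ is an $\ell$-leaky forcing set if for every choice of a set $L\subseteq V(G)$ of at most $\ell$ vertices (the leaks), starting with exactly the vertices of $B$ blue and repeatedly applying the color change rule, where vertices of $L$ are not allowed to perform forces, all vertices of $G$ eventually become blue. The $\ell$-leaky forcing number $Z_{(\ell)}(G)$ is the minimum cardinality of an $\ell$-leaky forcing set of $G$. For an induced subgraph $H$ of a $d$-dimensional grid graph, the boundary of $H$ is $\delta H=\{v\in V(H):\deg_H(v)\le 2d-1\}$. *)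

theory Defs
  imports Main "HOL-Library.FuncSet" "Graph_Theory.Graph_Theory"
begin

text \<open>
  A finite simple undirected graph is a \<^locale>\<open>pair_graph\<close>: a finite, symmetric, loop-free
  digraph without parallel arcs, an edge \<open>{u, v}\<close> being the two arcs \<open>(u, v)\<close> and \<open>(v, u)\<close>.
  Hence the degree of a vertex is its \<^const>\<open>out_degree\<close>.
\<close>

abbreviation degree :: "'a pair_pre_digraph \<Rightarrow> 'a \<Rightarrow> nat" where
  "degree G v \<equiv> out_degree (with_proj G) v"

definition path_graph :: "nat \<Rightarrow> nat pair_pre_digraph" where
  "path_graph n = \<lparr> pverts = {..<n}, parcs = {(i, j). i < n \<and> j < n \<and> (j = Suc i \<or> i = Suc j)} \<rparr>"

text \<open>
  Tuples are extensional functions on \<open>{..<d}\<close>, with coordinates numbered from \<open>0\<close>.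
\<close>

definition cartesian_product ::
    "nat \<Rightarrow> (nat \<Rightarrow> 'a pair_pre_digraph) \<Rightarrow> (nat \<Rightarrow> 'a) pair_pre_digraph" where
  "cartesian_product d G =
    \<lparr> pverts = (\<Pi>\<^sub>E k\<in>{..<d}. pverts (G k)),
      parcs = {(x, y). x \<in> (\<Pi>\<^sub>E k\<in>{..<d}. pverts (G k)) \<and> y \<in> (\<Pi>\<^sub>E k\<in>{..<d}. pverts (G k)) \<and>
        (\<exists>k<d. x k \<noteq> y k \<and> (\<forall>j<d. j \<noteq> k \<longrightarrow> x j = y j) \<and> (x k, y k) \<in> parcs (G k))} \<rparr>"

definition grid_graph :: "nat \<Rightarrow> (nat \<Rightarrow> nat) \<Rightarrow> (nat \<Rightarrow> nat) pair_pre_digraph" where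
  "grid_graph d n = cartesian_product d (\<lambda>k. path_graph (n k))"

text \<open>
  \<open>force_step G L X Y\<close>: from the colouring with blue set \<open>X\<close>, one force by a vertex outside the
  set \<open>L\<close> of leaks yields the colouring with blue set \<open>Y\<close>.
\<close>

definition force_step :: "'a pair_pre_digraph \<Rightarrow> 'a set \<Rightarrow> 'a set \<Rightarrow> 'a set \<Rightarrow> bool" where
  "force_step G L X Y \<longleftrightarrow>
    (\<exists>u v. u \<in> X \<and> u \<notin> L \<and> {w. (u, w) \<in> parcs G \<and> w \<notin> X} = {v} \<and> Y = insert v X)"

definition leaky_forcing_set :: "'a pair_pre_digraph \<Rightarrow> nat \<Rightarrow> 'a set \<Rightarrow> bool" where
  "leaky_forcing_set G l B \<longleftrightarrow> B \<subseteq> pverts G \<and>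
    (\<forall>L. L \<subseteq> pverts G \<and> finite L \<and> card L \<le> l \<longrightarrow> (force_step G L)\<^sup>*\<^sup>* B (pverts G))"

definition leaky_forcing_number :: "'a pair_pre_digraph \<Rightarrow> nat \<Rightarrow> nat" where
  "leaky_forcing_number G l = (LEAST k. \<exists>B. leaky_forcing_set G l B \<and> card B = k)"

definition boundary :: "nat \<Rightarrow> 'a pair_pre_digraph \<Rightarrow> 'a set" where
  "boundary d H = {v \<in> pverts H. degree H v \<le> 2 * d - 1}"

lemma leaky_forcing_set_pverts: "leaky_forcing_set G l (pverts G)"
  by (simp add: leaky_forcing_set_def)

lemma pair_graph_cartesian_product:
  assumes "\<And>k. k < d \<Longrightarrow> pair_graph (G k)"
  shows "pair_graph (cartesian_product d G)"
proof -
  have fin_G: "finite (pverts (G k))" if "k < d" for k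
  proof -
    interpret pair_graph "G k" using assms that .
    show ?thesis by (rule pair_finite_verts)
  qed
  have fin: "finite (\<Pi>\<^sub>E k\<in>{..<d}. pverts (G k))"
    by (rule finite_PiE) (simp_all add: fin_G)
  have sym: "(b, a) \<in> parcs (G k)" if "k < d" "(a, b) \<in> parcs (G k)" for a b k
  proof -
    interpret pair_graph "G k" using assms that(1) .
    show ?thesis using pair_sym_arcs that(2) unfolding symmetric_def with_proj_simps by (rule symD)
  qed
  show ?thesis
  proof unfold_locales
    show "finite (pverts (cartesian_product d G))"
      using fin by (simp add: cartesian_product_def)
    show "finite (parcs (cartesian_product d G))"
      by (rule finite_subset[OF _ finite_cartesian_product[OF fin fin]])
        (auto simp: cartesian_product_def)
    show "symmetric (with_proj (cartesian_product d G))"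
      unfolding symmetric_def with_proj_simps
    proof (rule symI)
      fix x y assume xy: "(x, y) \<in> parcs (cartesian_product d G)"
      then obtain k where k: "k < d" "x k \<noteq> y k" "\<forall>j<d. j \<noteq> k \<longrightarrow> x j = y j"
          "(x k, y k) \<in> parcs (G k)"
        by (auto simp: cartesian_product_def)
      have "\<exists>k<d. y k \<noteq> x k \<and> (\<forall>j<d. j \<noteq> k \<longrightarrow> y j = x j) \<and> (y k, x k) \<in> parcs (G k)"
        using k sym[OF k(1,4)] by (intro exI[of _ k]) simp
      with xy show "(y, x) \<in> parcs (cartesian_product d G)"
        by (simp add: cartesian_product_def)
    qed
  next
    fix e assume "e \<in> parcs (cartesian_product d G)"
    then show "fst e \<in> pverts (cartesian_product d G)" "snd e \<in> pverts (cartesian_product d G)"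
        "fst e \<noteq> snd e"
      unfolding cartesian_product_def by (cases e; simp; metis)+
  qed
qed

lemma pair_graph_path_graph: "pair_graph (path_graph n)"
proof unfold_locales
  show "finite (parcs (path_graph n))"
    by (rule finite_subset[of _ "{..<n} \<times> {..<n}"]) (auto simp: path_graph_def)
  show "symmetric (with_proj (path_graph n))"
    unfolding symmetric_def with_proj_simps by (rule symI) (auto simp: path_graph_def)
qed (auto simp: path_graph_def)

lemma pair_graph_grid_graph: "pair_graph (grid_graph d n)"
  unfolding grid_graph_def by (intro pair_graph_cartesian_product pair_graph_path_graph)

end

theory Submission
  imports Defs
begin

text \<open>
  A white vertex \<open>v\<close> all of whose neighbours are leaks is never forced, so every vertex of degree at
  most \<open>l\<close> belongs to every \<open>l\<close>-leaky forcing set. Conversely, suppose that \<open>W\<close> is a nonempty set of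
  white vertices containing no boundary vertex. Each of the \<open>2 d\<close> axis directions has an extremal
  vertex of \<open>W\<close>; its successor in that direction lies in \<open>H\<close>, is blue and has no other neighbour in
  \<open>W\<close>, so it forces unless it is a leak. These \<open>2 d\<close> successors are distinct, hence fewer than \<open>2 d\<close>
  leaks cannot stop the boundary from forcing.
\<close>

section \<open>Forcing sequences and the leaky forcing number\<close>

lemma degree_eq_card: "degree G v = card {w. (v, w) \<in> parcs G}"
proof -
  have "out_arcs (with_proj G) v = Pair v ` {w. (v, w) \<in> parcs G}"
    by (auto simp: out_arcs_def)
  then show ?thesis
    by (simp add: out_degree_def card_image inj_on_def)
qed

text \<open>Induction on the number of white vertices: forcing reaches \<open>V\<close> once no
  proper subset containing \<open>B\<close> is stuck.\<close>

lemma force_steps_exhaust: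
  assumes "finite V" and "B \<subseteq> V"
    and "\<And>X. B \<subseteq> X \<Longrightarrow> X \<subset> V \<Longrightarrow> \<exists>Y \<subseteq> V. X \<subset> Y \<and> force_step G L X Y"
  shows "(force_step G L)\<^sup>*\<^sup>* B V"
proof -
  have "(force_step G L)\<^sup>*\<^sup>* X V" if "B \<subseteq> X" "X \<subseteq> V" for X
    using that
  proof (induction "card (V - X)" arbitrary: X rule: less_induct)
    case less
    show ?case
    proof (cases "X = V")
      case False
      then obtain Y where Y: "Y \<subseteq> V" "X \<subset> Y" "force_step G L X Y"
        using assms(3)[OF less.prems(1)] less.prems(2) by auto
      then have "card (V - Y) < card (V - X)"
        using \<open>finite V\<close> by (intro psubset_card_mono) auto
      with Y less.hyps[of Y] less.prems show ?thesis
        by (meson converse_rtranclp_into_rtranclp order_trans psubset_imp_subset)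
    qed simp
  qed
  with assms(2) show ?thesis by simp
qed

lemma leaky_forcing_set_antimono:
  assumes "leaky_forcing_set G m B" and "l \<le> m"
  shows "leaky_forcing_set G l B"
  using assms by (auto simp: leaky_forcing_set_def)

lemma leaky_forcing_number_le:
  "leaky_forcing_set G l B \<Longrightarrow> leaky_forcing_number G l \<le> card B"
  unfolding leaky_forcing_number_def by (rule Least_le) blast

lemma leaky_forcing_number_attained:
  obtains B where "leaky_forcing_set G l B" and "card B = leaky_forcing_number G l"
  \<comment> \<open>The whole vertex set is a leaky forcing set, so the minimum is over a nonempty
    set.\<close>
  using LeastI_ex[of "\<lambda>k. \<exists>B. leaky_forcing_set G l B \<and> card B = k"] leaky_forcing_set_pverts
  unfolding leaky_forcing_number_def by blast

section \<open>Lower bound from low-degree vertices\<close>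

context pair_graph
begin

lemma parcs_commute: "(u, v) \<in> parcs G \<longleftrightarrow> (v, u) \<in> parcs G"
  using arcs_symmetric by blast

lemma low_degree_subset_leaky_forcing_set:
  assumes "leaky_forcing_set G l B"
  shows "{v \<in> pverts G. degree G v \<le> l} \<subseteq> B"
proof
  fix v assume v: "v \<in> {v \<in> pverts G. degree G v \<le> l}"
  \<comment> \<open>The adversary leaks the whole neighbourhood of \<open>v\<close>, which has at
    most \<open>l\<close> vertices.\<close>
  define L where "L = {w. (v, w) \<in> parcs G}"
  have "L \<subseteq> pverts G" using in_arcsD2 by (auto simp: L_def)
  moreover have "finite L" using \<open>L \<subseteq> pverts G\<close> finite_subset pair_finite_verts by blast
  moreover have "card L \<le> l" using v by (simp add: L_def degree_eq_card)
  ultimately have steps: "(force_step G L)\<^sup>*\<^sup>* B (pverts G)"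
    using assms by (auto simp: leaky_forcing_set_def)
  show "v \<in> B"
  proof (rule ccontr)
    assume "v \<notin> B"
    \<comment> \<open>A vertex forcing \<open>v\<close> would by symmetry be a neighbour of
      \<open>v\<close>, hence a leak.\<close>
    have "v \<notin> X" if "(force_step G L)\<^sup>*\<^sup>* B X" for X
      using that
    proof induction
      case (step X Y)
      then obtain u w where u: "u \<notin> L" "{w. (u, w) \<in> parcs G \<and> w \<notin> X} = {w}" "Y = insert w X"
        by (auto simp: force_step_def)
      from u(2) have "(u, w) \<in> parcs G" by blast
      with u(1) have "w \<noteq> v" using parcs_commute by (auto simp: L_def)
      with u(3) step.IH show ?case by simp
    qed (fact \<open>v \<notin> B\<close>)
    with steps v show False by blast
  qed
qed

lemma card_low_degree_le_leaky_forcing_number: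
  "card {v \<in> pverts G. degree G v \<le> l} \<le> leaky_forcing_number G l"
proof -
  obtain B where B: "leaky_forcing_set G l B" "card B = leaky_forcing_number G l"
    by (rule leaky_forcing_number_attained)
  have "finite B"
    using B(1) pair_finite_verts by (auto simp: leaky_forcing_set_def intro: finite_subset)
  from card_mono[OF this low_degree_subset_leaky_forcing_set[OF B(1)]] B(2)
  show ?thesis by simp
qed

end

section \<open>Axis neighbours in the grid\<close>

text \<open>
  The neighbour of \<open>w\<close> on axis \<open>fst p\<close>, upwards iff \<open>snd p\<close>. Truncated subtraction makes
  \<^term>\<open>shift w (k, False)\<close> equal to \<open>w\<close> if \<open>w k = 0\<close>; loop-freeness excludes this case.
\<close>

definition shift :: "(nat \<Rightarrow> nat) \<Rightarrow> nat \<times> bool \<Rightarrow> nat \<Rightarrow> nat" where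
  "shift w p = w(fst p := if snd p then Suc (w (fst p)) else w (fst p) - 1)"

lemma grid_graph_arcD:
  assumes "(x, y) \<in> parcs (grid_graph d n)"
  shows "x \<noteq> y" and "\<exists>p \<in> {..<d} \<times> UNIV. y = shift x p"
    and "\<exists>k<d. \<forall>j. j \<noteq> k \<longrightarrow> x j = y j"
proof -
  from assms obtain k where k: "k < d" "x k \<noteq> y k" "\<forall>j<d. j \<noteq> k \<longrightarrow> x j = y j"
      "(x k, y k) \<in> parcs (path_graph (n k))"
    and ext: "x \<in> extensional {..<d}" "y \<in> extensional {..<d}"
    by (auto simp: grid_graph_def cartesian_product_def PiE_def)
  from k(2) show "x \<noteq> y" by blast
  \<comment> \<open>Both tuples are \<open>undefined\<close> outside \<open>{..<d}\<close>, so they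
    agree there too.\<close>
  have eq: "x j = y j" if "j \<noteq> k" for j
    using k(3) ext that by (cases "j < d") (auto simp: extensional_def)
  then show "\<exists>k<d. \<forall>j. j \<noteq> k \<longrightarrow> x j = y j" using k(1) by blast
  have "y = shift x (k, y k = Suc (x k))"
    using k(4) eq by (auto simp: shift_def path_graph_def fun_eq_iff)
  with k(1) show "\<exists>p \<in> {..<d} \<times> UNIV. y = shift x p" by blast
qed

text \<open>All neighbours of \<open>w\<close> are among the at most \<open>2 * d\<close> vertices
  \<open>shift w p\<close>; degree at least \<open>2 * d\<close> leaves none of these out.\<close>

lemma shift_arc_of_large_degree:
  assumes "parcs H \<subseteq> parcs (grid_graph d n)" and "2 * d \<le> degree H w"
    and "p \<in> {..<d} \<times> UNIV"
  shows "(w, shift w p) \<in> parcs H"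
proof -
  let ?D = "{..<d} \<times> (UNIV :: bool set)"
  have "card (shift w ` ?D) \<le> 2 * d"
    using card_image_le[of ?D "shift w"] by (simp add: card_cartesian_product)
  moreover have "{v. (w, v) \<in> parcs H} \<subseteq> shift w ` ?D"
    using assms(1) grid_graph_arcD(2) by blast
  ultimately have "{v. (w, v) \<in> parcs H} = shift w ` ?D"
    using assms(2) by (intro card_seteq) (simp_all add: degree_eq_card)
  with assms(3) show ?thesis by blast
qed

section \<open>Extremal vertices of a finite set of grid points\<close>

definition beyond :: "(nat \<Rightarrow> nat) set \<Rightarrow> nat \<times> bool \<Rightarrow> (nat \<Rightarrow> nat) \<Rightarrow> bool" where
  "beyond W p u \<longleftrightarrow>
    (\<forall>v\<in>W. if snd p then v (fst p) < u (fst p) else u (fst p) < v (fst p))"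

lemma ex_shift_beyond:
  assumes "finite W" and "W \<noteq> {}"
    and "\<And>w. w \<in> W \<Longrightarrow> shift w p \<noteq> w"
  shows "\<exists>w\<in>W. beyond W p (shift w p)"
proof (cases "snd p")
  case True
  obtain w where "w \<in> W" "\<And>v. v \<in> W \<Longrightarrow> v (fst p) \<le> w (fst p)"
    using Max_in[of "(\<lambda>w. w (fst p)) ` W"] Max_ge[of "(\<lambda>w. w (fst p)) ` W"] assms(1,2)
    by (smt (verit) finite_imageI image_iff image_is_empty)
  then show ?thesis
    using True by (auto simp: beyond_def shift_def less_Suc_eq_le intro!: bexI[of _ w])
next
  case False
  obtain w where w: "w \<in> W" "\<And>v. v \<in> W \<Longrightarrow> w (fst p) \<le> v (fst p)"
    using Min_in[of "(\<lambda>w. w (fst p)) ` W"] Min_le[of "(\<lambda>w. w (fst p)) ` W"] assms(1,2)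
    by (smt (verit) finite_imageI image_iff image_is_empty)
  \<comment> \<open>At coordinate \<open>0\<close>, truncated subtraction would give
    \<open>shift w p = w\<close>.\<close>
  have "w (fst p) \<noteq> 0"
    using assms(3)[OF w(1)] False by (auto simp: shift_def fun_upd_idem_iff)
  with False w show ?thesis
    by (fastforce simp: beyond_def shift_def intro!: bexI[of _ w])
qed

text \<open>If the axes differ, the common vertex shares its coordinate \<open>fst p\<close> with
  \<open>f q\<close> in \<open>W\<close>, so it is not beyond \<open>W\<close> there. With opposite
  directions on one axis it would lie both above and below the points of \<open>W\<close>.\<close>

lemma inj_on_shift_beyond:
  assumes "\<And>p. p \<in> D \<Longrightarrow> f p \<in> W \<and> beyond W p (shift (f p) p)"
  shows "inj_on (\<lambda>p. shift (f p) p) D"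
proof (rule inj_onI)
  fix p q assume p: "p \<in> D" and q: "q \<in> D" and eq: "shift (f p) p = shift (f q) q"
  have "fst p = fst q"
  proof (rule ccontr)
    assume "fst p \<noteq> fst q"
    then have "shift (f p) p (fst p) = f q (fst p)"
      unfolding eq by (simp add: shift_def)
    with assms[OF p] assms[OF q] show False
      by (auto simp: beyond_def split: if_splits)
  qed
  moreover have "snd p = snd q"
    using assms[OF p] assms[OF q] eq \<open>fst p = fst q\<close>
    by (fastforce simp: beyond_def split: if_splits)
  ultimately show "p = q" by (rule prod_eqI)
qed

text \<open>Only a move along the axis of \<open>p\<close> can lead back into \<open>W\<close>, and
  that unit step back undoes the shift.\<close>

lemma beyond_adjacent_eq:
  assumes "(shift w p, v) \<in> parcs (grid_graph d n)"
    and "beyond W p (shift w p)" and "w \<in> W" and "v \<in> W"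
  shows "v = w"
proof -
  obtain k where k: "\<forall>j. j \<noteq> k \<longrightarrow> shift w p j = v j"
    using grid_graph_arcD(3)[OF assms(1)] by blast
  obtain q where q: "v = shift (shift w p) q"
    using grid_graph_arcD(2)[OF assms(1)] by blast
  \<comment> \<open>The instance for \<open>w\<close> rules out a truncated shift that leaves
    \<open>w\<close> fixed.\<close>
  have strict: "if snd p then v (fst p) < shift w p (fst p) else shift w p (fst p) < v (fst p)"
      "if snd p then w (fst p) < shift w p (fst p) else shift w p (fst p) < w (fst p)"
    using assms(2-4) by (auto simp: beyond_def)
  then have "fst q = fst p"
    unfolding q by (auto simp: shift_def split: if_splits)
  with strict show "v = w"
    unfolding q by (auto simp: shift_def fun_eq_iff split: if_splits)
qed

section \<open>Upper bound from the boundary\<close>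

lemma leaky_forcing_set_boundary:
  assumes "pair_graph H" and sub: "parcs H \<subseteq> parcs (grid_graph d n)" and "1 \<le> d"
  shows "leaky_forcing_set H (2 * d - 1) (boundary d H)"
  unfolding leaky_forcing_set_def
proof (intro conjI allI impI)
  interpret pair_graph H by fact
  show "boundary d H \<subseteq> pverts H" by (auto simp: boundary_def)
  fix L assume L: "L \<subseteq> pverts H \<and> finite L \<and> card L \<le> 2 * d - 1"
  show "(force_step H L)\<^sup>*\<^sup>* (boundary d H) (pverts H)"
  proof (rule force_steps_exhaust)
    fix X assume X: "boundary d H \<subseteq> X" "X \<subset> pverts H"
    let ?D = "{..<d} \<times> (UNIV :: bool set)"
    define W where "W = pverts H - X"
    have W: "finite W" "W \<noteq> {}"
      using X(2) pair_finite_verts by (auto simp: W_def)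
    \<comment> \<open>A white vertex is outside the boundary, so its degree is at least
      \<open>2 * d\<close>.\<close>
    have arc: "(w, shift w p) \<in> parcs H" if "w \<in> W" "p \<in> ?D" for w p
      using that X(1) \<open>1 \<le> d\<close>
      by (intro shift_arc_of_large_degree[OF sub]) (auto simp: W_def boundary_def)
    have "\<exists>w\<in>W. beyond W p (shift w p)" if "p \<in> ?D" for p
    proof (rule ex_shift_beyond[OF W])
      show "shift w p \<noteq> w" if "w \<in> W" for w
        using grid_graph_arcD(1) arc[OF that \<open>p \<in> ?D\<close>] sub by force
    qed
    then obtain f where f: "\<And>p. p \<in> ?D \<Longrightarrow> f p \<in> W \<and> beyond W p (shift (f p) p)"
      by metis
    have "\<not> (\<lambda>p. shift (f p) p) ` ?D \<subseteq> L"
    proof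
      assume "(\<lambda>p. shift (f p) p) ` ?D \<subseteq> L"
      then have "card ?D \<le> card L"
        using L inj_on_shift_beyond[OF f] card_inj_on_le by blast
      then have "2 * d \<le> card L" by (simp add: card_cartesian_product)
      \<comment> \<open>With \<open>1 \<le> d\<close> the subtraction is not truncated, so
        \<open>2 * d - 1 < 2 * d\<close>.\<close>
      with L \<open>1 \<le> d\<close> show False by linarith
    qed
    then obtain p where p: "p \<in> ?D" "shift (f p) p \<notin> L" by blast
    let ?u = "shift (f p) p"
    have u: "(f p, ?u) \<in> parcs H" "beyond W p ?u" "f p \<in> W"
      using arc f p(1) by auto
    have "?u \<notin> W" using u(2) by (auto simp: beyond_def)
    moreover have "?u \<in> pverts H" using u(1) in_arcsD2 by blast
    ultimately have "?u \<in> X" by (simp add: W_def)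
    moreover have "{v. (?u, v) \<in> parcs H \<and> v \<notin> X} = {f p}"
    proof -
      have "v = f p" if "(?u, v) \<in> parcs H" "v \<notin> X" for v
        using that beyond_adjacent_eq[OF _ u(2,3)] sub in_arcsD2 by (auto simp: W_def)
      then show ?thesis using u parcs_commute by (auto simp: W_def)
    qed
    ultimately have "force_step H L X (insert (f p) X)"
      using p(2) by (auto simp: force_step_def)
    with u(3) X(2) show "\<exists>Y \<subseteq> pverts H. X \<subset> Y \<and> force_step H L X Y"
      by (intro exI[of _ "insert (f p) X"]) (auto simp: W_def)
  qed (use pair_finite_verts in \<open>auto simp: boundary_def\<close>)
qed

lemma pair_graph_induced_subgraph:
  assumes "pair_graph G" and "induced_subgraph (with_proj H) (with_proj G)"
  shows "pair_graph H"
proof -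
  interpret G: pair_graph G by fact
  have V: "pverts H \<subseteq> pverts G"
    and E: "parcs H = {e \<in> parcs G. fst e \<in> pverts H \<and> snd e \<in> pverts H}"
    using assms(2) by (auto simp: induced_subgraph_def subgraph_def)
  show ?thesis
  proof unfold_locales
    show "symmetric (with_proj H)"
      using G.parcs_commute by (auto simp: symmetric_def E intro!: symI)
  qed (use V E G.pair_finite_verts G.pair_finite_arcs G.pair_no_loops
        in \<open>auto intro: finite_subset\<close>)
qed

theorem corollary9:
  fixes d l :: nat and n :: "nat \<Rightarrow> nat" and H :: "(nat \<Rightarrow> nat) pair_pre_digraph"
  assumes "\<And>k. k < d \<Longrightarrow> 1 \<le> n k"
    and "induced_subgraph (with_proj H) (with_proj (grid_graph d n))"
    and "2 \<le> l" and "l \<le> 2 * d - 1"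
  shows "card {v \<in> pverts H. degree H v \<le> l} \<le> leaky_forcing_number H l
    \<and> leaky_forcing_number H l \<le> card (boundary d H)
    \<and> (l = 2 * d - 1 \<longrightarrow> leaky_forcing_number H l = card (boundary d H))"
proof -
  interpret pair_graph H
    using pair_graph_induced_subgraph[OF pair_graph_grid_graph assms(2)] .
  have "parcs H \<subseteq> parcs (grid_graph d n)"
    using assms(2) unfolding induced_subgraph_def with_proj_simps by blast
  then have "leaky_forcing_set H (2 * d - 1) (boundary d H)"
    using assms(3,4) by (intro leaky_forcing_set_boundary[OF pair_graph_axioms]) simp_all
  \<comment> \<open>A set that withstands \<open>2 * d - 1\<close> leaks withstands any smaller
    number \<open>l\<close>.\<close>
  then have upper: "leaky_forcing_number H l \<le> card (boundary d H)"
    using assms(4) leaky_forcing_number_le leaky_forcing_set_antimono by blast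
  have lower: "card {v \<in> pverts H. degree H v \<le> l} \<le> leaky_forcing_number H l"
    by (rule card_low_degree_le_leaky_forcing_number)
  \<comment> \<open>At \<open>l = 2 * d - 1\<close> the low-degree set is the boundary itself, so
    the two bounds meet.\<close>
  from lower upper show ?thesis
    by (auto simp: boundary_def)
qed

end
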